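(* Let $\pi$ be a probability distribution on $(\mathsf{X},\mathscr{X})$ and $T_{1},T_{-1}$ sub-stochastic kernels with $\pi({\rm d}x)T_{1}(x,{\rm d}y)=\pi({\rm d}y)T_{-1}(y,{\rm d}x)$. Let $E=\mathsf{X}\times\{-1,1\}$, $\mu({\rm d}(x,v))=\tfrac12\pi({\rm d}x)\mathbb{I}\{v\in\{-1,1\}\}$. Let \[P(x,{\rm d}y)=\tfrac12T_{1}(x,{\rm d}y)+\tfrac12T_{-1}(x,{\rm d}y)+\delta_{x}({\rm d}y)\big(1-\tfrac12T_{1}(x,\mathsf{X})-\tfrac12T_{-1}(x,\mathsf{X})\big).\] Let $\rho_{1,-1},\rho_{-1,1}:\mathsf{X}\to\mathbb{R}$ satisfy $\rho_{v,-v}(x)-\rho_{-v,v}(x)=T_{-v}(x,\mathsf{X})-T_{v}(x,\mathsf{X})$ and $\tilde\rho_{v,-v}(x)\leq\rho_{v,-v}(x)\leq1-T_{v}(x,\mathsf{X})$ for all $(x,v)\in E$, where $\tilde\rho_{v,-v}(x)=\max\{0,T_{-v}(x,\mathsf{X})-T_{v}(x,\mathsf{X})\}$, and define \[P^{{\rm lifted},\rho}\big((x,v);{\rm d}(y,w)\big)=\mathbb{I}\{w=v\}\big[T_{v}(x,{\rm d}y)+\delta_{x}({\rm d}y)\big(1-T_{v}(x,\mathsf{X})-\rho_{v,-v}(x)\big)\big]+\mathbb{I}\{w=-v\}\delta_{x}({\rm d}y)\rho_{v,-v}(x).\] Then for any $\lambda\in[0,1)$ and $f\in L^{2}(\pi)$,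 ${\rm var}_{\lambda}(f,P^{{\rm lifted},\rho})\leq{\rm var}_{\lambda}(f,P)$.
   Context: For a Markov kernel $K$ leaving a probability $\nu$ invariant, $\lambda\in[0,1)$, $g\in L^{2}(\nu)$, $\bar g=g-\nu(g)$: ${\rm var}_{\lambda}(g,K)=\|\bar g\|_{\nu}^{2}+2\sum_{k\geq1}\lambda^{k}\langle\bar g,K^{k}\bar g\rangle_{\nu}$. For $f\in L^{2}(\pi)$, ${\rm var}_{\lambda}(f,P^{{\rm lifted},\rho})$ means ${\rm var}_{\lambda}(\breve f,P^{{\rm lifted},\rho})$ computed under $\mu$ with $\breve f(x,v)=f(x)$, while ${\rm var}_{\lambda}(f,P)$ is computed under $\pi$. *)

theory Defs
  imports "HOL-Probability.Probability"
begin

definition kact :: "('b \<Rightarrow> 'b measure) \<Rightarrow> ('b \<Rightarrow> real) \<Rightarrow> 'b \<Rightarrow> real" where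
  "kact K g x = (\<integral>y. g y \<partial>(K x))"

definition kmass :: "('b \<Rightarrow> 'b measure) \<Rightarrow> 'b \<Rightarrow> real" where
  "kmass K x = measure (K x) (space (K x))"

(* The kernel P(x,dy) = 1/2 T_1(x,dy) + 1/2 T_{-1}(x,dy) + delta_x(dy)(1 - 1/2 T_1(x,X) - 1/2 T_{-1}(x,X)),
   given by its action on functions.  T v is T_v for v in {-1,1}. *)
definition P_op :: "(int \<Rightarrow> 'a \<Rightarrow> 'a measure) \<Rightarrow> ('a \<Rightarrow> real) \<Rightarrow> 'a \<Rightarrow> real" where
  "P_op T g x = 1/2 * kact (T 1) g x + 1/2 * kact (T (-1)) g x
      + g x * (1 - 1/2 * kmass (T 1) x - 1/2 * kmass (T (-1)) x)"

(* The lifted kernel P^{lifted,rho}((x,v); d(y,w)), given by its action on functions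
   h : X x {-1,1} -> R;  rho v x stands for rho_{v,-v}(x). *)
definition Plift_op :: "(int \<Rightarrow> 'a \<Rightarrow> 'a measure) \<Rightarrow> (int \<Rightarrow> 'a \<Rightarrow> real)
      \<Rightarrow> ('a \<times> int \<Rightarrow> real) \<Rightarrow> 'a \<times> int \<Rightarrow> real" where
  "Plift_op T \<rho> h = (\<lambda>(x, v). kact (T v) (\<lambda>y. h (y, v)) x
      + h (x, v) * (1 - kmass (T v) x - \<rho> v x) + h (x, -v) * \<rho> v x)"

definition var_lam :: "'b measure \<Rightarrow> (('b \<Rightarrow> real) \<Rightarrow> ('b \<Rightarrow> real)) \<Rightarrow> real \<Rightarrow> ('b \<Rightarrow> real) \<Rightarrow> real" where
  "var_lam \<nu> K lam g =
     (let gb = (\<lambda>x. g x - (\<integral>y. g y \<partial>\<nu>)) in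
       (\<integral>x. (gb x)\<^sup>2 \<partial>\<nu>)
       + 2 * (\<Sum>k. lam ^ Suc k * (\<integral>x. gb x * (K ^^ Suc k) gb x \<partial>\<nu>)))"

definition lift_measure :: "'a measure \<Rightarrow> ('a \<times> int) measure" where
  "lift_measure \<pi> = \<pi> \<Otimes>\<^sub>M uniform_count_measure {-1, 1}"

end

theory Submission
  imports Defs
begin

text \<open>
  Write \<open>L\<close> for the lifted operator on \<open>L\<^sup>2(\<mu>)\<close> and \<open>Q\<close> for the velocity flip; reversibility says that
  the adjoint of \<open>L\<close> is \<open>QLQ\<close>. On functions of \<open>x\<close> alone, the quadratic form of \<open>L\<close> is that of the
  self-adjoint operator \<open>P\<close>. Let \<open>u = (1 - \<lambda>L)\<^sup>-\<^sup>1 g\<close> with \<open>g\<close> centred, and let \<open>e\<close>, \<open>o\<close> be its parts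
  that are even and odd in the velocity. The cross terms in \<open>\<langle>u, Lu\<rangle>\<close> cancel, so
  \<open>\<langle>g, e\<rangle> = \<langle>u, (1 - \<lambda>L)u\<rangle> = \<langle>e, (1 - \<lambda>P)e\<rangle> + \<langle>o, (1 - \<lambda>L)o\<rangle> \<ge> \<langle>e, (1 - \<lambda>P)e\<rangle>\<close>.
  The variational formula \<open>\<langle>g, (1 - \<lambda>P)\<^sup>-\<^sup>1 g\<rangle> \<ge> 2\<langle>g, e\<rangle> - \<langle>e, (1 - \<lambda>P)e\<rangle>\<close> then gives
  \<open>\<langle>g, u\<rangle> \<le> \<langle>g, (1 - \<lambda>P)\<^sup>-\<^sup>1 g\<rangle>\<close>. The resolvents are replaced by partial sums of their Neumann series,
  with errors of order \<open>\<lambda>\<^sup>n\<close>, so that no completeness of \<open>L\<^sup>2\<close> is needed.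
\<close>

section \<open>Square-integrable functions\<close>

definition L2 :: "'a measure \<Rightarrow> ('a \<Rightarrow> real) set" where
  "L2 M = {g \<in> borel_measurable M. integrable M (\<lambda>x. (g x)\<^sup>2)}"

definition ip :: "'a measure \<Rightarrow> ('a \<Rightarrow> real) \<Rightarrow> ('a \<Rightarrow> real) \<Rightarrow> real" where
  "ip M g h = (\<integral>x. g x * h x \<partial>M)"

lemma L2_measurable: "g \<in> L2 M \<Longrightarrow> g \<in> borel_measurable M"
  by (simp add: L2_def)

lemma L2_integrable_power2: "g \<in> L2 M \<Longrightarrow> integrable M (\<lambda>x. (g x)\<^sup>2)"
  by (simp add: L2_def)

lemma abs_mult_le_half_power2: "\<bar>a * b\<bar> \<le> (a\<^sup>2 + b\<^sup>2) / 2" for a b :: real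
  using sum_squares_bound[of "\<bar>a\<bar>" "\<bar>b\<bar>"] by (simp add: abs_mult)

lemma L2_integrable_mult:
  assumes "g \<in> L2 M" "h \<in> L2 M"
  shows "integrable M (\<lambda>x. g x * h x)"
proof (rule Bochner_Integration.integrable_bound)
  show "integrable M (\<lambda>x. ((g x)\<^sup>2 + (h x)\<^sup>2) / 2)"
    using assms by (simp add: L2_def)
  show "(\<lambda>x. g x * h x) \<in> borel_measurable M"
    using assms by (auto simp: L2_def)
  show "AE x in M. norm (g x * h x) \<le> norm (((g x)\<^sup>2 + (h x)\<^sup>2) / 2)"
  proof (rule AE_I2)
    fix x
    have "norm (((g x)\<^sup>2 + (h x)\<^sup>2) / 2) = ((g x)\<^sup>2 + (h x)\<^sup>2) / 2"
      by simp
    then show "norm (g x * h x) \<le> norm (((g x)\<^sup>2 + (h x)\<^sup>2) / 2)"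
      using abs_mult_le_half_power2[of "g x" "h x"] by simp
  qed
qed

lemma integrable_power2_mult:
  assumes g: "g \<in> L2 M" and c: "(\<lambda>x. g x * c x) \<in> L2 M"
  shows "integrable M (\<lambda>x. (g x)\<^sup>2 * c x)"
  using L2_integrable_mult[OF g c] by (simp add: power2_eq_square mult.assoc)

lemma L2_scale: "g \<in> L2 M \<Longrightarrow> (\<lambda>x. c * g x) \<in> L2 M"
  by (auto simp: L2_def power_mult_distrib)

lemma L2_add:
  assumes "g \<in> L2 M" "h \<in> L2 M"
  shows "(\<lambda>x. g x + h x) \<in> L2 M"
proof -
  have "integrable M (\<lambda>x. (g x)\<^sup>2 + (h x)\<^sup>2 + 2 * (g x * h x))"
    using assms L2_integrable_mult[OF assms] by (simp add: L2_def)
  then show ?thesis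
    using assms by (auto simp: L2_def power2_sum mult.assoc)
qed

lemma L2_add_scale: "g \<in> L2 M \<Longrightarrow> h \<in> L2 M \<Longrightarrow> (\<lambda>x. g x + c * h x) \<in> L2 M"
  by (intro L2_add L2_scale)

lemma L2_diff: "g \<in> L2 M \<Longrightarrow> h \<in> L2 M \<Longrightarrow> (\<lambda>x. g x - h x) \<in> L2 M"
  using L2_add_scale[of g M h "-1"] by simp

lemma L2_zero: "(\<lambda>x. 0) \<in> L2 M"
  by (simp add: L2_def)

lemma L2_sum: "(\<And>i. i \<in> I \<Longrightarrow> g i \<in> L2 M) \<Longrightarrow> (\<lambda>x. \<Sum>i\<in>I. g i x) \<in> L2 M"
  by (induction I rule: infinite_finite_induct) (auto intro: L2_add L2_zero)

lemma L2_bounded_mult: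
  assumes g: "g \<in> L2 M" and c: "c \<in> borel_measurable M" "\<And>x. x \<in> space M \<Longrightarrow> \<bar>c x\<bar> \<le> 1"
  shows "(\<lambda>x. g x * c x) \<in> L2 M"
proof -
  have "integrable M (\<lambda>x. (g x * c x)\<^sup>2)"
  proof (rule Bochner_Integration.integrable_bound[OF L2_integrable_power2[OF g]])
    show "(\<lambda>x. (g x * c x)\<^sup>2) \<in> borel_measurable M"
      using g c by (auto simp: L2_def)
    show "AE x in M. norm ((g x * c x)\<^sup>2) \<le> norm ((g x)\<^sup>2)"
    proof (rule AE_I2)
      fix x assume "x \<in> space M"
      then have "(c x)\<^sup>2 \<le> 1"
        using c(2) by (simp add: abs_square_le_1)
      then have "(g x)\<^sup>2 * (c x)\<^sup>2 \<le> (g x)\<^sup>2 * 1"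
        by (intro mult_left_mono) auto
      then show "norm ((g x * c x)\<^sup>2) \<le> norm ((g x)\<^sup>2)"
        by (simp add: power_mult_distrib)
    qed
  qed
  then show ?thesis
    using g c by (auto simp: L2_def)
qed

lemma ip_commute: "ip M g h = ip M h g"
  by (simp add: ip_def mult.commute)

lemma ip_nonneg: "0 \<le> ip M g g"
  by (simp add: ip_def)

lemma ip_add_scale_right:
  assumes "g \<in> L2 M" "h \<in> L2 M" "h' \<in> L2 M"
  shows "ip M g (\<lambda>x. h x + c * h' x) = ip M g h + c * ip M g h'"
proof -
  have "ip M g (\<lambda>x. h x + c * h' x) = (\<integral>x. g x * h x + c * (g x * h' x) \<partial>M)"
    by (simp add: ip_def algebra_simps)
  then show ?thesis
    using L2_integrable_mult[OF assms(1,2)] L2_integrable_mult[OF assms(1,3)] by (simp add: ip_def)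
qed

lemma ip_add_scale_left:
  "g \<in> L2 M \<Longrightarrow> h \<in> L2 M \<Longrightarrow> h' \<in> L2 M \<Longrightarrow> ip M (\<lambda>x. h x + c * h' x) g = ip M h g + c * ip M h' g"
  by (simp add: ip_commute[of M _ g] ip_add_scale_right)

lemma ip_zero [simp]: "ip M g (\<lambda>x. 0) = 0" "ip M (\<lambda>x. 0) g = 0"
  by (simp_all add: ip_def)

text \<open>The inequality of arithmetic and geometric means stands in for Cauchy-Schwarz. Comparing
  or absorbing squared norms is enough later, and no square roots appear.\<close>

lemma abs_ip_le:
  assumes "g \<in> L2 M" "h \<in> L2 M"
  shows "2 * \<bar>ip M g h\<bar> \<le> ip M g g + ip M h h"
proof -
  have "\<bar>ip M g h\<bar> \<le> (\<integral>x. \<bar>g x * h x\<bar> \<partial>M)"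
    unfolding ip_def by (rule integral_abs_bound)
  also have "\<dots> \<le> (\<integral>x. ((g x)\<^sup>2 + (h x)\<^sup>2) / 2 \<partial>M)"
    using assms L2_integrable_mult[OF assms]
    by (intro integral_mono abs_mult_le_half_power2) (auto simp: L2_def)
  also have "\<dots> = (ip M g g + ip M h h) / 2"
    using assms by (simp add: L2_def ip_def power2_eq_square)
  finally show ?thesis by simp
qed

section \<open>Resolvents of contractions\<close>

locale L2_contraction =
  fixes M :: "'a measure" and K :: "('a \<Rightarrow> real) \<Rightarrow> 'a \<Rightarrow> real"
  \<comment> \<open>Linearity is only weak: \<open>kact\<close> takes junk values on the null set where integrability fails.\<close>
  assumes closed: "g \<in> L2 M \<Longrightarrow> K g \<in> L2 M"
    and ip_linear: "\<lbrakk>h \<in> L2 M; g \<in> L2 M; g' \<in> L2 M\<rbrakk> \<Longrightarrow>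
      ip M h (K (\<lambda>x. g x + c * g' x)) = ip M h (K g) + c * ip M h (K g')"
    and contraction: "g \<in> L2 M \<Longrightarrow> ip M (K g) (K g) \<le> ip M g g"
begin

lemma power_closed: "g \<in> L2 M \<Longrightarrow> (K ^^ n) g \<in> L2 M"
  by (induction n) (auto intro: closed)

lemma power_contraction: "g \<in> L2 M \<Longrightarrow> ip M ((K ^^ n) g) ((K ^^ n) g) \<le> ip M g g"
  by (induction n) (auto intro: order_trans[OF contraction] power_closed)

text \<open>Weak linearity with \<open>g = g' = 0\<close> and \<open>c = -1\<close> expresses the
  pairing as its difference with itself.\<close>

lemma ip_K_zero: "h \<in> L2 M \<Longrightarrow> ip M h (K (\<lambda>x. 0)) = 0"
  using ip_linear[of h "\<lambda>x. 0" "\<lambda>x. 0" "-1"] L2_zero[of M] by simp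

text \<open>A contraction satisfies <g, K g> <= <g, g>, so the quadratic form of
  \<open>1 - lam K\<close> is nonnegative. For \<open>P_op\<close> this yields the variational
  bound; for the lifted operator it allows the odd part to be dropped.\<close>

lemma coercive:
  assumes g: "g \<in> L2 M" and "0 \<le> lam" "lam < 1"
  shows "lam * ip M g (K g) \<le> ip M g g"
proof -
  have "ip M g (K g) \<le> ip M g g"
    using abs_ip_le[OF g closed[OF g]] contraction[OF g] by linarith
  then have "lam * ip M g (K g) \<le> lam * ip M g g"
    using assms by (intro mult_left_mono) auto
  also have "\<dots> \<le> ip M g g"
    using assms ip_nonneg[of M g] by (simp add: mult_left_le_one_le)
  finally show ?thesis .
qed

text \<open>The first \<open>n\<close> terms of the Neumann series of (1 - lam K)^(-1) g, as a
  pointwise finite sum, so that it is an honest function in \<open>L2\<close>.\<close>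

definition resolvent_sum :: "real \<Rightarrow> ('a \<Rightarrow> real) \<Rightarrow> nat \<Rightarrow> 'a \<Rightarrow> real" where
  "resolvent_sum lam g n x = (\<Sum>k<n. lam ^ k * (K ^^ k) g x)"

lemma resolvent_sum_L2: "g \<in> L2 M \<Longrightarrow> resolvent_sum lam g n \<in> L2 M"
  unfolding resolvent_sum_def[abs_def] by (intro L2_sum L2_scale power_closed)

lemma resolvent_sum_0: "resolvent_sum lam g 0 = (\<lambda>x. 0)"
  by (simp add: resolvent_sum_def[abs_def])

lemma resolvent_sum_Suc:
  "resolvent_sum lam g (Suc n) = (\<lambda>x. resolvent_sum lam g n x + lam ^ n * (K ^^ n) g x)"
  by (simp add: resolvent_sum_def[abs_def])

lemma ip_resolvent_sum:
  assumes "g \<in> L2 M" "h \<in> L2 M"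
  shows "ip M h (resolvent_sum lam g n) = (\<Sum>k<n. lam ^ k * ip M h ((K ^^ k) g))"
  using assms
  by (induction n)
    (simp_all add: resolvent_sum_0 resolvent_sum_Suc ip_add_scale_right resolvent_sum_L2 power_closed)

text \<open>Telescoping: \<open>1 - lam K\<close> maps the partial sum to \<open>g\<close> minus the
  remainder \<open>lam ^ n * (K ^^ n) g\<close>. The identity is tested against \<open>h\<close>
  because \<open>K\<close> is linear only inside inner products.\<close>

lemma resolvent_sum_equation:
  assumes "g \<in> L2 M" "h \<in> L2 M"
  shows "ip M h (resolvent_sum lam g n) - lam * ip M h (K (resolvent_sum lam g n))
    = ip M h g - lam ^ n * ip M h ((K ^^ n) g)"
  using assms
  by (induction n)
    (simp_all add: resolvent_sum_0 resolvent_sum_Suc ip_K_zero ip_linear ip_add_scale_right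
      resolvent_sum_L2 power_closed algebra_simps)

lemma abs_ip_power_le:
  assumes "g \<in> L2 M" "h \<in> L2 M" "ip M h h \<le> ip M g g"
  shows "\<bar>ip M h ((K ^^ k) g)\<bar> \<le> ip M g g"
  using abs_ip_le[OF assms(2) power_closed[OF assms(1), of k]] power_contraction[OF assms(1), of k]
    assms(3) by linarith

text \<open>Termwise domination by a geometric series gives a bound uniform in \<open>n\<close>.
  With a remainder iterate as \<open>h\<close>, the factor \<open>lam ^ n\<close> then makes the
  truncation error vanish.\<close>

lemma abs_ip_resolvent_sum_le:
  assumes "g \<in> L2 M" "h \<in> L2 M" "ip M h h \<le> ip M g g" and lam: "0 \<le> lam" "lam < 1"
  shows "\<bar>ip M h (resolvent_sum lam g n)\<bar> \<le> ip M g g / (1 - lam)"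
proof -
  have "\<bar>ip M h (resolvent_sum lam g n)\<bar> \<le> (\<Sum>k<n. lam ^ k * ip M g g)"
    unfolding ip_resolvent_sum[OF assms(1,2)] using lam abs_ip_power_le[OF assms(1-3)]
    by (intro order_trans[OF sum_abs] sum_mono) (simp add: abs_mult mult_left_mono)
  also have "\<dots> = ip M g g * (\<Sum>k<n. lam ^ k)"
    by (simp add: sum_distrib_left mult.commute)
  also have "\<dots> \<le> ip M g g * (\<Sum>k. lam ^ k)"
    using lam by (intro mult_left_mono sum_le_suminf ip_nonneg) (auto simp: summable_geometric)
  also have "\<dots> = ip M g g / (1 - lam)"
    using lam by (simp add: suminf_geometric)
  finally show ?thesis .
qed

text \<open>The series is dominated by a geometric one. Its term of index 0 is split off because
  \<open>var_lam\<close> doubles only the later terms.\<close>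

lemma ip_resolvent_sum_tendsto:
  assumes g: "g \<in> L2 M" and lam: "0 \<le> lam" "lam < 1"
  shows "(\<lambda>n. ip M g (resolvent_sum lam g n))
    \<longlonglongrightarrow> ip M g g + (\<Sum>k. lam ^ Suc k * ip M g ((K ^^ Suc k) g))"
proof -
  have "summable (\<lambda>k. lam ^ k * ip M g ((K ^^ k) g))"
  proof (rule summable_comparison_test')
    show "summable (\<lambda>k. lam ^ k * ip M g g)"
      using lam by (intro summable_mult2 summable_geometric) auto
    show "norm (lam ^ k * ip M g ((K ^^ k) g)) \<le> lam ^ k * ip M g g" if "0 \<le> k" for k
      using lam abs_ip_power_le[OF g g order_refl, of k] by (simp add: abs_mult mult_left_mono)
  qed
  from summable_LIMSEQ[OF this] suminf_split_head[OF this]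
  show ?thesis
    by (simp add: ip_resolvent_sum[OF g g] algebra_simps)
qed

end

section \<open>The lifted measure\<close>

lemma space_lift_measure: "space (lift_measure M) = space M \<times> {-1, 1}"
  by (simp add: lift_measure_def space_pair_measure space_uniform_count_measure)

lemma measurable_lift_measure_iff:
  "h \<in> measurable (lift_measure M) N \<longleftrightarrow> (\<forall>v\<in>{-1, 1}. (\<lambda>x. h (x, v)) \<in> measurable M N)"
proof
  assume h: "h \<in> measurable (lift_measure M) N"
  have "(\<lambda>x. (x, v)) \<in> measurable M (lift_measure M)" if "v \<in> {-1, 1}" for v
    unfolding lift_measure_def using that
    by (intro measurable_Pair) (auto simp: space_uniform_count_measure)
  from measurable_compose[OF this h]
  show "\<forall>v\<in>{-1, 1}. (\<lambda>x. h (x, v)) \<in> measurable M N"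
    by auto
next
  assume h: "\<forall>v\<in>{-1, 1}. (\<lambda>x. h (x, v)) \<in> measurable M N"
  have "(\<lambda>p. h (fst p, snd p)) \<in> measurable (M \<Otimes>\<^sub>M uniform_count_measure {-1, 1}) N"
  \<comment> \<open>The velocity takes only two values, so \<open>h\<close> is a countable family of
    functions of the position, selected by the measurable index \<open>snd\<close>.\<close>
  proof (rule measurable_compose_countable'[where f="\<lambda>v p. h (fst p, v)" and g=snd and I="{-1, 1}"])
    show "(\<lambda>p. h (fst p, v)) \<in> measurable (M \<Otimes>\<^sub>M uniform_count_measure {-1, 1}) N" if "v \<in> {-1, 1}" for v
      using h that by (intro measurable_compose[OF measurable_fst]) auto
    show "snd \<in> measurable (M \<Otimes>\<^sub>M uniform_count_measure {-1, 1}) (count_space {-1, 1})"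
      by measurable
  qed simp
  then show "h \<in> measurable (lift_measure M) N"
    by (simp add: lift_measure_def)
qed

lemma nn_integral_lift_measure:
  assumes "h \<in> borel_measurable (lift_measure M)"
  shows "(\<integral>\<^sup>+p. h p \<partial>lift_measure M) = ((\<integral>\<^sup>+x. h (x, 1) \<partial>M) + (\<integral>\<^sup>+x. h (x, -1) \<partial>M)) / 2"
proof -
  interpret U: prob_space "uniform_count_measure {-1, 1 :: int}"
    by (rule prob_space_uniform_count_measure) auto
  have m: "(\<lambda>x. h (x, 1)) \<in> borel_measurable M" "(\<lambda>x. h (x, -1)) \<in> borel_measurable M"
    using assms by (auto simp: measurable_lift_measure_iff)
  have "(\<integral>\<^sup>+p. h p \<partial>lift_measure M) = (\<integral>\<^sup>+x. \<integral>\<^sup>+v. h (x, v) \<partial>uniform_count_measure {-1, 1} \<partial>M)"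
    using assms unfolding lift_measure_def by (simp add: U.nn_integral_fst)
  also have "\<dots> = (\<integral>\<^sup>+x. (h (x, 1) + h (x, -1)) / 2 \<partial>M)"
    by (simp add: uniform_count_measure_def nn_integral_point_measure_finite add_divide_distrib_ennreal
        divide_ennreal_def algebra_simps)
  also have "\<dots> = ((\<integral>\<^sup>+x. h (x, 1) \<partial>M) + (\<integral>\<^sup>+x. h (x, -1) \<partial>M)) / 2"
    using m by (simp add: nn_integral_divide nn_integral_add)
  finally show ?thesis .
qed

lemma integrable_lift_measure_iff:
  fixes h :: "'a \<times> int \<Rightarrow> real"
  shows "integrable (lift_measure M) h \<longleftrightarrow> (\<forall>v\<in>{-1, 1}. integrable M (\<lambda>x. h (x, v)))"
proof (cases "h \<in> borel_measurable (lift_measure M)")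
  case True
  then have "(\<lambda>p. ennreal (norm (h p))) \<in> borel_measurable (lift_measure M)"
    by simp
  from nn_integral_lift_measure[OF this] True show ?thesis
    by (auto simp: integrable_iff_bounded measurable_lift_measure_iff ennreal_divide_eq_top_iff less_top[symmetric])
qed (auto simp: integrable_iff_bounded measurable_lift_measure_iff)

lemma integral_lift_measure:
  fixes h :: "'a \<times> int \<Rightarrow> real"
  assumes "sigma_finite_measure M" "\<And>v. v \<in> {-1, 1} \<Longrightarrow> integrable M (\<lambda>x. h (x, v))"
  shows "(\<integral>p. h p \<partial>lift_measure M) = ((\<integral>x. h (x, 1) \<partial>M) + (\<integral>x. h (x, -1) \<partial>M)) / 2"
proof -
  interpret U: prob_space "uniform_count_measure {-1, 1 :: int}"
    by (rule prob_space_uniform_count_measure) auto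
  interpret sigma_finite_measure M by fact
  interpret pair_sigma_finite M "uniform_count_measure {-1, 1 :: int}" ..
  have "integrable (lift_measure M) h"
    using assms(2) by (simp add: integrable_lift_measure_iff)
  then have "(\<integral>p. h p \<partial>lift_measure M) = (\<integral>x. \<integral>v. h (x, v) \<partial>uniform_count_measure {-1, 1} \<partial>M)"
    by (simp add: integral_fst' lift_measure_def)
  then show ?thesis
    using assms(2) by (simp add: integral_uniform_count_measure)
qed

lemma L2_lift_measure_iff:
  "h \<in> L2 (lift_measure M) \<longleftrightarrow> (\<forall>v\<in>{-1, 1}. (\<lambda>x. h (x, v)) \<in> L2 M)"
  by (auto simp: L2_def measurable_lift_measure_iff integrable_lift_measure_iff)

lemma ip_lift_measure:
  assumes "sigma_finite_measure M" "g \<in> L2 (lift_measure M)" "h \<in> L2 (lift_measure M)"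
  shows "ip (lift_measure M) g h =
    (ip M (\<lambda>x. g (x, 1)) (\<lambda>x. h (x, 1)) + ip M (\<lambda>x. g (x, -1)) (\<lambda>x. h (x, -1))) / 2"
  unfolding ip_def using assms
  by (subst integral_lift_measure) (auto simp: L2_lift_measure_iff intro: L2_integrable_mult)

section \<open>The reversible pair of kernels\<close>

text \<open>Monotone class induction on \<open>b\<close>. The weights \<open>a\<close> and
  \<open>d\<close> are arbitrary so that the lemma can be applied twice to the reversibility
  relation, once for each of its two test functions.\<close>

lemma nn_integral_kernel_eqI:
  fixes a b d
  assumes \<kappa>[measurable]: "\<kappa> \<in> M \<rightarrow>\<^sub>M subprob_algebra N"
    and [measurable]: "a \<in> borel_measurable M" "d \<in> borel_measurable N"
    and eq: "\<And>B. B \<in> sets N \<Longrightarrow>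
      (\<integral>\<^sup>+x. a x * emeasure (\<kappa> x) B \<partial>M) = (\<integral>\<^sup>+y. indicator B y * d y \<partial>N)"
    and b: "b \<in> borel_measurable N"
  shows "(\<integral>\<^sup>+x. a x * (\<integral>\<^sup>+y. b y \<partial>\<kappa> x) \<partial>M) = (\<integral>\<^sup>+y. b y * d y \<partial>N)"
  using b
proof (induction rule: borel_measurable_induct)
  case (cong f g)
  have "(\<integral>\<^sup>+y. f y \<partial>\<kappa> x) = (\<integral>\<^sup>+y. g y \<partial>\<kappa> x)" if "x \<in> space M" for x
    using cong(3) sets_eq_imp_space_eq[OF sets_kernel[OF \<kappa> that]] by (intro nn_integral_cong) auto
  then have "(\<integral>\<^sup>+x. a x * (\<integral>\<^sup>+y. f y \<partial>\<kappa> x) \<partial>M) = (\<integral>\<^sup>+x. a x * (\<integral>\<^sup>+y. g y \<partial>\<kappa> x) \<partial>M)"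
    by (intro nn_integral_cong) auto
  moreover have "(\<integral>\<^sup>+y. f y * d y \<partial>N) = (\<integral>\<^sup>+y. g y * d y \<partial>N)"
    using cong(3) by (intro nn_integral_cong) auto
  ultimately show ?case
    using cong(4) by simp
next
  case (set B)
  then have "(\<integral>\<^sup>+x. a x * (\<integral>\<^sup>+y. indicator B y \<partial>\<kappa> x) \<partial>M) = (\<integral>\<^sup>+x. a x * emeasure (\<kappa> x) B \<partial>M)"
    by (intro nn_integral_cong) (simp add: sets_kernel[OF \<kappa>])
  with eq[OF set] show ?case by simp
next
  case (mult u c)
  note [measurable] = mult(2)
  have "(\<integral>\<^sup>+x. a x * (\<integral>\<^sup>+y. c * u y \<partial>\<kappa> x) \<partial>M) = (\<integral>\<^sup>+x. c * (a x * (\<integral>\<^sup>+y. u y \<partial>\<kappa> x)) \<partial>M)"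
    by (intro nn_integral_cong)
      (simp add: nn_integral_cmult measurable_cong_sets[OF sets_kernel[OF \<kappa>] refl] mult(2) mult.left_commute)
  also have "\<dots> = c * (\<integral>\<^sup>+x. a x * (\<integral>\<^sup>+y. u y \<partial>\<kappa> x) \<partial>M)"
    by (intro nn_integral_cmult) measurable
  also have "\<dots> = c * (\<integral>\<^sup>+y. u y * d y \<partial>N)"
    by (simp only: mult)
  also have "\<dots> = (\<integral>\<^sup>+y. (c * u y) * d y \<partial>N)"
    by (subst nn_integral_cmult[symmetric]) (simp_all add: mult.assoc)
  finally show ?case .
next
  case (add u w)
  note [measurable] = add.hyps(1,3)
  have "(\<integral>\<^sup>+x. a x * (\<integral>\<^sup>+y. w y + u y \<partial>\<kappa> x) \<partial>M)
      = (\<integral>\<^sup>+x. a x * (\<integral>\<^sup>+y. w y \<partial>\<kappa> x) + a x * (\<integral>\<^sup>+y. u y \<partial>\<kappa> x) \<partial>M)"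
    by (intro nn_integral_cong)
      (simp add: nn_integral_add measurable_cong_sets[OF sets_kernel[OF \<kappa>] refl] add.hyps(1,3) distrib_left)
  also have "\<dots> = (\<integral>\<^sup>+x. a x * (\<integral>\<^sup>+y. w y \<partial>\<kappa> x) \<partial>M) + (\<integral>\<^sup>+x. a x * (\<integral>\<^sup>+y. u y \<partial>\<kappa> x) \<partial>M)"
    by (intro nn_integral_add) measurable
  also have "\<dots> = (\<integral>\<^sup>+y. w y * d y \<partial>N) + (\<integral>\<^sup>+y. u y * d y \<partial>N)"
    by (simp only: add)
  also have "\<dots> = (\<integral>\<^sup>+y. (w y + u y) * d y \<partial>N)"
    by (subst nn_integral_add[symmetric]) (simp_all add: distrib_right)
  finally show ?case .
next
  case (seq U)
  note [measurable] = seq(1)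
  have mono: "U i y \<le> U j y" if "i \<le> j" for i j y
    using seq(3) that by (auto simp: incseq_def le_fun_def)
  have "(\<integral>\<^sup>+x. a x * (\<integral>\<^sup>+y. (SUP i. U i) y \<partial>\<kappa> x) \<partial>M)
      = (\<integral>\<^sup>+x. (SUP i. a x * (\<integral>\<^sup>+y. U i y \<partial>\<kappa> x)) \<partial>M)"
  proof (intro nn_integral_cong)
    fix x assume x: "x \<in> space M"
    have "(\<integral>\<^sup>+y. (SUP i. U i) y \<partial>\<kappa> x) = (SUP i. \<integral>\<^sup>+y. U i y \<partial>\<kappa> x)"
      unfolding SUP_apply using seq(1,3) x
      by (intro nn_integral_monotone_convergence_SUP)
        (auto simp: measurable_cong_sets[OF sets_kernel[OF \<kappa>] refl])
    then show "a x * (\<integral>\<^sup>+y. (SUP i. U i) y \<partial>\<kappa> x) = (SUP i. a x * (\<integral>\<^sup>+y. U i y \<partial>\<kappa> x))"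
      by (simp add: SUP_mult_left_ennreal)
  qed
  also have "\<dots> = (SUP i. \<integral>\<^sup>+x. a x * (\<integral>\<^sup>+y. U i y \<partial>\<kappa> x) \<partial>M)"
    by (intro nn_integral_monotone_convergence_SUP)
      (auto simp: incseq_def le_fun_def intro!: mult_left_mono nn_integral_mono mono)
  also have "\<dots> = (SUP i. \<integral>\<^sup>+y. U i y * d y \<partial>N)"
    by (simp only: seq)
  also have "\<dots> = (\<integral>\<^sup>+y. (SUP i. U i y * d y) \<partial>N)"
    by (intro nn_integral_monotone_convergence_SUP[symmetric])
      (auto simp: incseq_def le_fun_def intro!: mult_right_mono mono)
  also have "\<dots> = (\<integral>\<^sup>+y. (SUP i. U i) y * d y \<partial>N)"
    by (simp only: SUP_apply SUP_mult_right_ennreal)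
  finally show ?case .
qed

lemma (in finite_measure) L2_integrable: "g \<in> L2 M \<Longrightarrow> integrable M g"
  unfolding L2_def by (rule square_integrable_imp_integrable) auto

text \<open>Optimising over \<open>t\<close> gives Jensen's inequality; the affine form can be added up over the three
  terms of the lifted kernel before choosing \<open>t\<close>.\<close>

lemma (in subprob_space) power2_integral_tangent:
  fixes g :: "'a \<Rightarrow> real"
  assumes g: "g \<in> L2 M"
  shows "2 * t * (\<integral>x. g x \<partial>M) - t\<^sup>2 * measure M (space M) \<le> (\<integral>x. (g x)\<^sup>2 \<partial>M)"
proof -
  have i: "integrable M g"
    using g by (rule L2_integrable)
  have "0 \<le> (\<integral>x. (g x - t)\<^sup>2 \<partial>M)"
    by simp
  also have "\<dots> = (\<integral>x. (g x)\<^sup>2 - 2 * t * g x + t\<^sup>2 \<partial>M)"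
    by (intro Bochner_Integration.integral_cong refl) (simp add: power2_diff mult.commute mult.left_commute)
  also have "\<dots> = (\<integral>x. (g x)\<^sup>2 \<partial>M) - 2 * t * (\<integral>x. g x \<partial>M) + t\<^sup>2 * measure M (space M)"
    using i L2_integrable_power2[OF g] by simp
  finally show ?thesis by simp
qed

text \<open>The bounds on \<open>\<rho>\<close> make each row of the lifted kernel a probability;
  \<open>rho_diff\<close>, together with reversibility, makes the lifted measure invariant.\<close>

locale lifted_chain = prob_space \<pi> for \<pi> :: "'a measure" +
  fixes T :: "int \<Rightarrow> 'a \<Rightarrow> 'a measure" and \<rho> :: "int \<Rightarrow> 'a \<Rightarrow> real"
  assumes kern: "\<And>v. v \<in> {-1, 1} \<Longrightarrow> T v \<in> \<pi> \<rightarrow>\<^sub>M subprob_algebra \<pi>"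
    and rev: "\<And>A B. A \<in> sets \<pi> \<Longrightarrow> B \<in> sets \<pi> \<Longrightarrow>
        (\<integral>x. indicator A x * measure (T 1 x) B \<partial>\<pi>) = (\<integral>y. indicator B y * measure (T (-1) y) A \<partial>\<pi>)"
    and rho_meas: "\<And>v. v \<in> {-1, 1} \<Longrightarrow> \<rho> v \<in> borel_measurable \<pi>"
    and rho_diff: "\<And>x v. x \<in> space \<pi> \<Longrightarrow> v \<in> {-1, 1} \<Longrightarrow>
        \<rho> v x - \<rho> (-v) x = kmass (T (-v)) x - kmass (T v) x"
    and rho_nonneg: "\<And>x v. x \<in> space \<pi> \<Longrightarrow> v \<in> {-1, 1} \<Longrightarrow> 0 \<le> \<rho> v x"
    and rho_up: "\<And>x v. x \<in> space \<pi> \<Longrightarrow> v \<in> {-1, 1} \<Longrightarrow> \<rho> v x \<le> 1 - kmass (T v) x"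
begin

lemma sets_T: "v \<in> {-1, 1} \<Longrightarrow> x \<in> space \<pi> \<Longrightarrow> sets (T v x) = sets \<pi>"
  using sets_kernel[OF kern] .

lemma space_T: "v \<in> {-1, 1} \<Longrightarrow> x \<in> space \<pi> \<Longrightarrow> space (T v x) = space \<pi>"
  using sets_eq_imp_space_eq[OF sets_T] .

lemma subprob_T: "v \<in> {-1, 1} \<Longrightarrow> x \<in> space \<pi> \<Longrightarrow> subprob_space (T v x)"
  using subprob_space_kernel[OF kern] .

lemma measurable_T: "v \<in> {-1, 1} \<Longrightarrow> x \<in> space \<pi> \<Longrightarrow> g \<in> measurable \<pi> N \<Longrightarrow> g \<in> measurable (T v x) N"
  using measurable_cong_sets[OF sets_T refl] by blast

lemma neg_sign: "v \<in> {-1, 1 :: int} \<Longrightarrow> -v \<in> {-1, 1}"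
  by auto

lemma kmass_measurable: "v \<in> {-1, 1} \<Longrightarrow> kmass (T v) \<in> borel_measurable \<pi>"
proof -
  assume v: "v \<in> {-1, 1}"
  have "(\<lambda>x. measure (T v x) (space \<pi>)) \<in> borel_measurable \<pi>"
    using kern[OF v] by measurable
  then show ?thesis
    by (rule measurable_cong[THEN iffD1, rotated]) (simp add: kmass_def space_T[OF v])
qed

lemma kmass_nonneg: "0 \<le> kmass (T v) x"
  by (simp add: kmass_def)

lemma kmass_le_1: "v \<in> {-1, 1} \<Longrightarrow> x \<in> space \<pi> \<Longrightarrow> kmass (T v) x \<le> 1"
  unfolding kmass_def using subprob_space.subprob_measure_le_1[OF subprob_T] .

lemma kact_measurable:
  "v \<in> {-1, 1} \<Longrightarrow> g \<in> borel_measurable \<pi> \<Longrightarrow> kact (T v) g \<in> borel_measurable \<pi>"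
  unfolding kact_def[abs_def] by (rule measurable_compose[OF kern integral_measurable_subprob_algebra])

lemma nn_kernel_measurable:
  "v \<in> {-1, 1} \<Longrightarrow> g \<in> borel_measurable \<pi> \<Longrightarrow> (\<lambda>x. \<integral>\<^sup>+y. g y \<partial>T v x) \<in> borel_measurable \<pi>"
  by (rule measurable_compose[OF kern nn_integral_measurable_subprob_algebra])

section \<open>Reversibility for sets and for nonnegative functions\<close>

lemma nn_reversible_sets:
  assumes v: "v \<in> {-1, 1}" and [measurable]: "A \<in> sets \<pi>" "B \<in> sets \<pi>"
  shows "(\<integral>\<^sup>+x. indicator A x * emeasure (T v x) B \<partial>\<pi>)
    = (\<integral>\<^sup>+y. indicator B y * emeasure (T (-v) y) A \<partial>\<pi>)"
proof -
  \<comment> \<open>All masses are at most 1, so the real integrals of the hypothesis are genuine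
    and agree with the extended nonnegative ones.\<close>
  have nn: "(\<integral>\<^sup>+x. indicator A x * emeasure (T v x) B \<partial>\<pi>) = ennreal (\<integral>x. indicator A x * measure (T v x) B \<partial>\<pi>)"
    if v: "v \<in> {-1, 1}" and [measurable]: "A \<in> sets \<pi>" "B \<in> sets \<pi>" for v A B
  proof -
    note [measurable] = kern[OF v]
    have "integrable \<pi> (\<lambda>x. indicator A x * measure (T v x) B)"
    proof (rule integrable_const_bound[where B=1])
      show "AE x in \<pi>. norm (indicator A x * measure (T v x) B) \<le> 1"
        using subprob_space.subprob_measure_le_1[OF subprob_T[OF v]] by (auto simp: indicator_def)
    qed measurable
    from nn_integral_eq_integral[OF this]
    have "ennreal (\<integral>x. indicator A x * measure (T v x) B \<partial>\<pi>) = (\<integral>\<^sup>+x. ennreal (indicator A x * measure (T v x) B) \<partial>\<pi>)"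
      by simp
    also have "\<dots> = (\<integral>\<^sup>+x. indicator A x * emeasure (T v x) B \<partial>\<pi>)"
    proof (intro nn_integral_cong)
      fix x assume "x \<in> space \<pi>"
      then interpret subprob_space "T v x" by (rule subprob_T[OF v])
      show "ennreal (indicator A x * measure (T v x) B) = indicator A x * emeasure (T v x) B"
        by (simp add: emeasure_eq_measure indicator_def)
    qed
    finally show ?thesis ..
  qed
  \<comment> \<open>The hypothesis is the case \<open>v = 1\<close>; exchanging \<open>A\<close> and
    \<open>B\<close> in it gives \<open>v = -1\<close>.\<close>
  have "(\<integral>x. indicator A x * measure (T v x) B \<partial>\<pi>) = (\<integral>y. indicator B y * measure (T (-v) y) A \<partial>\<pi>)"
    using v rev[of A B] rev[of B A] assms(2,3) by auto
  with nn[OF v assms(2,3)] nn[OF neg_sign[OF v] assms(3,2)] show ?thesis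
    by simp
qed

text \<open>One test function is extended at a time: first the indicator of \<open>B\<close> becomes
  \<open>b\<close> with \<open>A\<close> fixed, then the indicator of \<open>A\<close> becomes
  \<open>a\<close> by the same principle for the kernel \<open>T (-v)\<close>.\<close>

lemma nn_reversible:
  assumes v: "v \<in> {-1, 1}" and a: "a \<in> borel_measurable \<pi>" and b: "b \<in> borel_measurable \<pi>"
  shows "(\<integral>\<^sup>+x. a x * (\<integral>\<^sup>+y. b y \<partial>T v x) \<partial>\<pi>) = (\<integral>\<^sup>+y. b y * (\<integral>\<^sup>+x. a x \<partial>T (-v) y) \<partial>\<pi>)"
proof -
  have nv: "-v \<in> {-1, 1}" using v by (rule neg_sign)
  have "(\<integral>\<^sup>+x. indicator A x * (\<integral>\<^sup>+y. b y \<partial>T v x) \<partial>\<pi>) = (\<integral>\<^sup>+y. b y * emeasure (T (-v) y) A \<partial>\<pi>)"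
    if A: "A \<in> sets \<pi>" for A
  proof (rule nn_integral_kernel_eqI[OF kern[OF v] _ _ nn_reversible_sets[OF v A] b])
    show "indicator A \<in> borel_measurable \<pi>"
      using A by simp
    show "(\<lambda>y. emeasure (T (-v) y) A) \<in> borel_measurable \<pi>"
      using kern[OF nv] A by measurable
  qed
  from nn_integral_kernel_eqI[OF kern[OF nv] b nn_kernel_measurable[OF v b] this[symmetric] a]
  show ?thesis by (rule sym)
qed

text \<open>All three facts come from reversibility against the constant 1: integrating
  \<open>T v\<close> applied to \<open>g\<^sup>2\<close> moves the kernel onto the constant, where
  only the mass of \<open>T (-v)\<close> remains. That mass is at most 1, so the total is finite and
  the inner integrals are finite almost everywhere.\<close>

lemma
  assumes v: "v \<in> {-1, 1}" and g: "g \<in> L2 \<pi>"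
  shows AE_L2_T: "AE x in \<pi>. g \<in> L2 (T v x)"
    and integrable_kact_power2: "integrable \<pi> (kact (T v) (\<lambda>y. (g y)\<^sup>2))"
    and integral_kact_power2: "(\<integral>x. kact (T v) (\<lambda>y. (g y)\<^sup>2) x \<partial>\<pi>) = (\<integral>y. (g y)\<^sup>2 * kmass (T (-v)) y \<partial>\<pi>)"
proof -
  have nv: "-v \<in> {-1, 1}" using v by (rule neg_sign)
  note [measurable] = L2_measurable[OF g]
  note km[measurable] = kmass_measurable[OF nv]
  have ka[measurable]: "kact (T v) (\<lambda>y. (g y)\<^sup>2) \<in> borel_measurable \<pi>"
    using v by (intro kact_measurable) auto
  have int: "integrable \<pi> (\<lambda>y. (g y)\<^sup>2 * kmass (T (-v)) y)"
  proof (rule Bochner_Integration.integrable_bound[OF L2_integrable_power2[OF g]])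
    show "AE x in \<pi>. norm ((g x)\<^sup>2 * kmass (T (-v)) x) \<le> norm ((g x)\<^sup>2)"
      using kmass_le_1[OF nv] kmass_nonneg by (auto simp: abs_mult mult_left_le)
  qed measurable
  have "(\<integral>\<^sup>+x. \<integral>\<^sup>+y. ennreal ((g y)\<^sup>2) \<partial>T v x \<partial>\<pi>) = (\<integral>\<^sup>+y. ennreal ((g y)\<^sup>2) * (\<integral>\<^sup>+x. 1 \<partial>T (-v) y) \<partial>\<pi>)"
    using nn_reversible[OF v, of "\<lambda>x. 1" "\<lambda>y. ennreal ((g y)\<^sup>2)"] by simp
  also have "\<dots> = (\<integral>\<^sup>+y. ennreal ((g y)\<^sup>2 * kmass (T (-v)) y) \<partial>\<pi>)"
  proof (intro nn_integral_cong)
    fix x assume "x \<in> space \<pi>"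
    then interpret subprob_space "T (-v) x" by (rule subprob_T[OF nv])
    show "ennreal ((g x)\<^sup>2) * (\<integral>\<^sup>+y. 1 \<partial>T (-v) x) = ennreal ((g x)\<^sup>2 * kmass (T (-v)) x)"
      by (simp add: emeasure_eq_measure kmass_def ennreal_mult)
  qed
  also have "\<dots> = ennreal (\<integral>y. (g y)\<^sup>2 * kmass (T (-v)) y \<partial>\<pi>)"
    using int by (intro nn_integral_eq_integral) (auto simp: kmass_nonneg)
  finally have nn: "(\<integral>\<^sup>+x. \<integral>\<^sup>+y. ennreal ((g y)\<^sup>2) \<partial>T v x \<partial>\<pi>) = ennreal (\<integral>y. (g y)\<^sup>2 * kmass (T (-v)) y \<partial>\<pi>)" .
  have "AE x in \<pi>. (\<integral>\<^sup>+y. ennreal ((g y)\<^sup>2) \<partial>T v x) \<noteq> \<infinity>"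
    using nn by (intro nn_integral_PInf_AE nn_kernel_measurable[OF v]) auto
  then show AE: "AE x in \<pi>. g \<in> L2 (T v x)"
    using AE_space
  proof eventually_elim
    case (elim x)
    then have [measurable]: "g \<in> borel_measurable (T v x)"
      by (intro measurable_T[OF v]) auto
    from elim show ?case
      by (auto simp: L2_def integrable_iff_bounded less_top[symmetric])
  qed
  have "(\<integral>\<^sup>+x. ennreal (kact (T v) (\<lambda>y. (g y)\<^sup>2) x) \<partial>\<pi>) = (\<integral>\<^sup>+x. \<integral>\<^sup>+y. ennreal ((g y)\<^sup>2) \<partial>T v x \<partial>\<pi>)"
    using AE
  proof (intro nn_integral_cong_AE, eventually_elim)
    case (elim x)
    then show ?case
      by (simp add: kact_def nn_integral_eq_integral L2_def)
  qed
  with nn have eq: "(\<integral>\<^sup>+x. ennreal (kact (T v) (\<lambda>y. (g y)\<^sup>2) x) \<partial>\<pi>) = ennreal (\<integral>y. (g y)\<^sup>2 * kmass (T (-v)) y \<partial>\<pi>)"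
    by simp
  have nonneg: "0 \<le> kact (T v) (\<lambda>y. (g y)\<^sup>2) x" for x
    by (simp add: kact_def)
  show "integrable \<pi> (kact (T v) (\<lambda>y. (g y)\<^sup>2))"
    using eq nonneg by (intro integrableI_nonneg) auto
  have "0 \<le> (\<integral>y. (g y)\<^sup>2 * kmass (T (-v)) y \<partial>\<pi>)"
    by (simp add: kmass_nonneg)
  then show "(\<integral>x. kact (T v) (\<lambda>y. (g y)\<^sup>2) x \<partial>\<pi>) = (\<integral>y. (g y)\<^sup>2 * kmass (T (-v)) y \<partial>\<pi>)"
    using nonneg eq by (subst integral_eq_nn_integral) auto
qed

lemma kact_L2:
  assumes v: "v \<in> {-1, 1}" and g: "g \<in> L2 \<pi>"
  shows "kact (T v) g \<in> L2 \<pi>"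
proof -
  note [measurable] = kact_measurable[OF v L2_measurable[OF g]]
  have "integrable \<pi> (\<lambda>x. (kact (T v) g x)\<^sup>2)"
  proof (rule Bochner_Integration.integrable_bound[OF integrable_kact_power2[OF v g]])
    show "AE x in \<pi>. norm ((kact (T v) g x)\<^sup>2) \<le> norm (kact (T v) (\<lambda>y. (g y)\<^sup>2) x)"
      using AE_L2_T[OF v g] AE_space
    proof eventually_elim
      case (elim x)
      \<comment> \<open>For total mass m the optimal tangent point is ?t / m; since m <= 1, the
        point ?t already gives Jensen's bound and avoids a division.\<close>
      let ?t = "kact (T v) g x"
      from elim have "?t\<^sup>2 * kmass (T v) x \<le> ?t\<^sup>2"
        using kmass_le_1[OF v] by (simp add: mult_left_le)
      then have "?t\<^sup>2 \<le> kact (T v) (\<lambda>y. (g y)\<^sup>2) x"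
        using subprob_space.power2_integral_tangent[OF subprob_T[OF v elim(2)] elim(1), of ?t]
        by (simp add: kact_def kmass_def power2_eq_square)
      then show ?case by simp
    qed
  qed measurable
  then show ?thesis by (simp add: L2_def)
qed

lemma AE_kact_add_scale:
  assumes v: "v \<in> {-1, 1}" and g: "g \<in> L2 \<pi>" and h: "h \<in> L2 \<pi>"
  shows "AE x in \<pi>. kact (T v) (\<lambda>y. g y + c * h y) x = kact (T v) g x + c * kact (T v) h x"
  using AE_L2_T[OF v g] AE_L2_T[OF v h] AE_space
proof eventually_elim
  case (elim x)
  interpret subprob_space "T v x" using elim by (intro subprob_T v)
  have "integrable (T v x) g" "integrable (T v x) h"
    using elim by (auto intro: L2_integrable)
  then show ?case by (simp add: kact_def)
qed

text \<open>Integration against \<open>k\<close> ignores the null set on which \<open>g\<close> or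
  \<open>h\<close> fails to be integrable under \<open>T v x\<close>, so the almost sure linearity
  becomes an identity.\<close>

lemma ip_kact_add_scale:
  assumes v: "v \<in> {-1, 1}" and k: "k \<in> L2 \<pi>" and g: "g \<in> L2 \<pi>" and h: "h \<in> L2 \<pi>"
  shows "ip \<pi> k (kact (T v) (\<lambda>y. g y + c * h y)) = ip \<pi> k (kact (T v) g) + c * ip \<pi> k (kact (T v) h)"
proof -
  have "ip \<pi> k (kact (T v) (\<lambda>y. g y + c * h y)) = ip \<pi> k (\<lambda>x. kact (T v) g x + c * kact (T v) h x)"
    unfolding ip_def
  proof (rule integral_cong_AE)
    note [measurable] = L2_measurable[OF k] kact_measurable[OF v L2_measurable[OF g]]
      kact_measurable[OF v L2_measurable[OF h]] kact_measurable[OF v L2_measurable[OF L2_add_scale[OF g h, of c]]]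
    show "(\<lambda>x. k x * kact (T v) (\<lambda>y. g y + c * h y) x) \<in> borel_measurable \<pi>"
      "(\<lambda>x. k x * (kact (T v) g x + c * kact (T v) h x)) \<in> borel_measurable \<pi>"
      by measurable
    show "AE x in \<pi>. k x * kact (T v) (\<lambda>y. g y + c * h y) x = k x * (kact (T v) g x + c * kact (T v) h x)"
      using AE_kact_add_scale[OF v g h, of c] by eventually_elim simp
  qed
  then show ?thesis
    using assms by (simp add: ip_add_scale_right kact_L2)
qed

section \<open>The two kernels as mutual adjoints\<close>

lemma ip_kact_swap_nonneg:
  assumes v: "v \<in> {-1, 1}" and a: "a \<in> L2 \<pi>" "\<And>x. 0 \<le> a x" and b: "b \<in> L2 \<pi>" "\<And>x. 0 \<le> b x"
  shows "ip \<pi> a (kact (T v) b) = ip \<pi> b (kact (T (-v)) a)"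
proof -
  have *: "ennreal (ip \<pi> a (kact (T v) b)) = (\<integral>\<^sup>+x. ennreal (a x) * (\<integral>\<^sup>+y. ennreal (b y) \<partial>T v x) \<partial>\<pi>)"
    if v: "v \<in> {-1, 1}" and a: "a \<in> L2 \<pi>" "\<And>x. 0 \<le> a x" and b: "b \<in> L2 \<pi>" "\<And>x. 0 \<le> b x" for a b v
  proof -
    have AE: "AE x in \<pi>. ennreal (a x * kact (T v) b x) = ennreal (a x) * (\<integral>\<^sup>+y. ennreal (b y) \<partial>T v x)"
      using AE_L2_T[OF v b(1)] AE_space
    proof eventually_elim
      case (elim x)
      interpret subprob_space "T v x" using elim by (intro subprob_T v)
      have "integrable (T v x) b"
        using elim by (auto intro: L2_integrable)
      then show ?case
        using a(2) b(2) by (simp add: kact_def nn_integral_eq_integral ennreal_mult)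
    qed
    have "ennreal (ip \<pi> a (kact (T v) b)) = (\<integral>\<^sup>+x. ennreal (a x * kact (T v) b x) \<partial>\<pi>)"
      unfolding ip_def using L2_integrable_mult[OF a(1) kact_L2[OF v b(1)]] a(2) b(2)
      by (intro nn_integral_eq_integral[symmetric]) (auto simp: kact_def)
    also have "\<dots> = (\<integral>\<^sup>+x. ennreal (a x) * (\<integral>\<^sup>+y. ennreal (b y) \<partial>T v x) \<partial>\<pi>)"
      using AE by (rule nn_integral_cong_AE)
    finally show ?thesis .
  qed
  have "ennreal (ip \<pi> a (kact (T v) b)) = ennreal (ip \<pi> b (kact (T (-v)) a))"
    using *[OF v a b] *[OF neg_sign[OF v] b a] nn_reversible[OF v, of "\<lambda>x. ennreal (a x)" "\<lambda>x. ennreal (b x)"]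
      L2_measurable[OF a(1)] L2_measurable[OF b(1)] by simp
  then show ?thesis
    using a(2) b(2) by (simp add: ip_def kact_def)
qed

text \<open>Both functions are split into positive and negative parts. Bilinearity reduces the claim
  to nonnegative pairs, where the integrals can be exchanged without integrability concerns.\<close>

lemma ip_kact_swap:
  assumes v: "v \<in> {-1, 1}" and a: "a \<in> L2 \<pi>" and b: "b \<in> L2 \<pi>"
  shows "ip \<pi> a (kact (T v) b) = ip \<pi> b (kact (T (-v)) a)"
proof -
  have nv: "-v \<in> {-1, 1}" using v by (rule neg_sign)
  define p n where "p = (\<lambda>(g :: 'a \<Rightarrow> real) x. max 0 (g x))" and "n = (\<lambda>(g :: 'a \<Rightarrow> real) x. max 0 (- g x))"
  have L: "p g \<in> L2 \<pi>" "n g \<in> L2 \<pi>" if g: "g \<in> L2 \<pi>" for g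
  proof -
    note [measurable] = L2_measurable[OF g]
    have "integrable \<pi> (\<lambda>x. (p g x)\<^sup>2)" "integrable \<pi> (\<lambda>x. (n g x)\<^sup>2)"
      by (rule Bochner_Integration.integrable_bound[OF L2_integrable_power2[OF g]]; simp add: p_def n_def max_def)+
    then show "p g \<in> L2 \<pi>" "n g \<in> L2 \<pi>"
      by (auto simp: L2_def p_def n_def)
  qed
  \<comment> \<open>The difference is written with the factor \<open>-1\<close> to match the
    linearity rules for \<open>g + c * h\<close>.\<close>
  have split: "g = (\<lambda>x. p g x + (-1) * n g x)" for g
    by (auto simp: p_def n_def)
  have nonneg: "0 \<le> p g x" "0 \<le> n g x" for g x
    by (auto simp: p_def n_def)
  have expand: "ip \<pi> a (kact (T v) b) = ip \<pi> (p a) (kact (T v) (p b)) - ip \<pi> (n a) (kact (T v) (p b))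
      - (ip \<pi> (p a) (kact (T v) (n b)) - ip \<pi> (n a) (kact (T v) (n b)))"
    if "v \<in> {-1, 1}" "a \<in> L2 \<pi>" "b \<in> L2 \<pi>" for a b v
    using that
    by (subst split[of a], subst split[of b])
      (simp add: ip_kact_add_scale[where c="-1", simplified] ip_add_scale_left[where c="-1", simplified] L2_diff L kact_L2)
  show ?thesis
    unfolding expand[OF v a b] expand[OF nv b a]
    using a b by (simp add: ip_kact_swap_nonneg[OF v] L nonneg)
qed

end

section \<open>The lifted operator\<close>

definition lift_fun :: "('a \<Rightarrow> real) \<Rightarrow> 'a \<times> int \<Rightarrow> real" where
  "lift_fun e = (\<lambda>(x, v). e x)"

definition flip :: "('a \<times> int \<Rightarrow> real) \<Rightarrow> 'a \<times> int \<Rightarrow> real" where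
  "flip h = (\<lambda>(x, v). h (x, -v))"

text \<open>The result lives on positions rather than on pairs. This makes averaging over the
  velocity the adjoint of \<open>lift_fun\<close>.\<close>

definition even_part :: "('a \<times> int \<Rightarrow> real) \<Rightarrow> 'a \<Rightarrow> real" where
  "even_part h x = (h (x, 1) + h (x, -1)) / 2"

lemma flip_lift_fun: "flip (lift_fun e) = lift_fun e"
  by (simp add: flip_def lift_fun_def)

lemma flip_L2: "h \<in> L2 (lift_measure M) \<Longrightarrow> flip h \<in> L2 (lift_measure M)"
  by (auto simp: L2_lift_measure_iff flip_def)

lemma lift_fun_L2: "e \<in> L2 M \<Longrightarrow> lift_fun e \<in> L2 (lift_measure M)"
  by (auto simp: L2_lift_measure_iff lift_fun_def)

lemma even_part_L2:
  assumes "h \<in> L2 (lift_measure M)"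
  shows "even_part h \<in> L2 M"
proof -
  have "(\<lambda>x. 1 / 2 * (h (x, 1) + h (x, -1))) \<in> L2 M"
    using assms by (intro L2_scale L2_add) (auto simp: L2_lift_measure_iff)
  then show ?thesis
    by (simp add: even_part_def[abs_def])
qed

context lifted_chain
begin

abbreviation \<mu> :: "('a \<times> int) measure" where "\<mu> \<equiv> lift_measure \<pi>"

lemma ip_\<mu>:
  "g \<in> L2 \<mu> \<Longrightarrow> h \<in> L2 \<mu> \<Longrightarrow> ip \<mu> g h =
    (ip \<pi> (\<lambda>x. g (x, 1)) (\<lambda>x. h (x, 1)) + ip \<pi> (\<lambda>x. g (x, -1)) (\<lambda>x. h (x, -1))) / 2"
  using sigma_finite_measure_axioms by (rule ip_lift_measure)

lemma slice_L2: "h \<in> L2 \<mu> \<Longrightarrow> v \<in> {-1, 1} \<Longrightarrow> (\<lambda>x. h (x, v)) \<in> L2 \<pi>"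
  unfolding L2_lift_measure_iff by blast

lemma ip_lift_fun:
  assumes "e \<in> L2 \<pi>" "h \<in> L2 \<mu>"
  shows "ip \<mu> (lift_fun e) h = ip \<pi> e (even_part h)"
proof -
  have "even_part h = (\<lambda>x. 1 / 2 * h (x, 1) + 1 / 2 * h (x, -1))"
    by (auto simp: even_part_def add_divide_distrib)
  \<comment> \<open>Homogeneity is the linearity rule with zero as its first summand.\<close>
  moreover have "ip \<pi> e (\<lambda>x. 1 / 2 * h (x, 1)) = 1 / 2 * ip \<pi> e (\<lambda>x. h (x, 1))"
    using ip_add_scale_right[OF assms(1) L2_zero slice_L2[OF assms(2)], of 1 "1 / 2"] by simp
  ultimately have "ip \<pi> e (even_part h) = (ip \<pi> e (\<lambda>x. h (x, 1)) + ip \<pi> e (\<lambda>x. h (x, -1))) / 2"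
    using ip_add_scale_right[OF assms(1) L2_scale[OF slice_L2[OF assms(2)]] slice_L2[OF assms(2)], of 1 "-1" "1 / 2" "1 / 2"]
    by simp
  then show ?thesis
    using assms by (simp add: ip_\<mu> lift_fun_L2) (simp add: lift_fun_def)
qed

lemma ip_lift_fun_lift_fun: "a \<in> L2 \<pi> \<Longrightarrow> b \<in> L2 \<pi> \<Longrightarrow> ip \<mu> (lift_fun a) (lift_fun b) = ip \<pi> a b"
  by (simp add: ip_lift_fun lift_fun_L2) (simp add: lift_fun_def even_part_def[abs_def])

definition hold :: "int \<Rightarrow> 'a \<Rightarrow> real" where
  "hold v x = 1 - kmass (T v) x - \<rho> v x"

lemma hold_measurable: "v \<in> {-1, 1} \<Longrightarrow> hold v \<in> borel_measurable \<pi>"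
  unfolding hold_def[abs_def]
  by (intro borel_measurable_diff borel_measurable_const kmass_measurable rho_meas)

lemma hold_nonneg: "v \<in> {-1, 1} \<Longrightarrow> x \<in> space \<pi> \<Longrightarrow> 0 \<le> hold v x"
  using rho_up[of x v] by (simp add: hold_def)

lemma hold_le_1: "v \<in> {-1, 1} \<Longrightarrow> x \<in> space \<pi> \<Longrightarrow> hold v x \<le> 1"
  using rho_nonneg[of x v] kmass_nonneg[of v x] by (simp add: hold_def)

lemma rho_le_1: "v \<in> {-1, 1} \<Longrightarrow> x \<in> space \<pi> \<Longrightarrow> \<rho> v x \<le> 1"
  using rho_up[of x v] kmass_nonneg[of v x] by simp

text \<open>This is \<open>rho_diff\<close> rearranged. The holding probability does not depend on
  the velocity, so the holding term commutes with \<open>flip\<close>.\<close>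

lemma hold_flip: "v \<in> {-1, 1} \<Longrightarrow> x \<in> space \<pi> \<Longrightarrow> hold (-v) x = hold v x"
  using rho_diff[of x v] by (simp add: hold_def)

lemma L2_mult_hold: "v \<in> {-1, 1} \<Longrightarrow> g \<in> L2 \<pi> \<Longrightarrow> (\<lambda>x. g x * hold v x) \<in> L2 \<pi>"
  using hold_nonneg hold_le_1 by (intro L2_bounded_mult hold_measurable) auto

lemma L2_mult_rho: "v \<in> {-1, 1} \<Longrightarrow> g \<in> L2 \<pi> \<Longrightarrow> (\<lambda>x. g x * \<rho> v x) \<in> L2 \<pi>"
  using rho_nonneg rho_le_1 by (intro L2_bounded_mult rho_meas) auto

lemma Plift_op_apply:
  "Plift_op T \<rho> h (x, v) = kact (T v) (\<lambda>y. h (y, v)) x + h (x, v) * hold v x + h (x, -v) * \<rho> v x"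
  by (simp add: Plift_op_def hold_def)

lemma Plift_op_L2:
  assumes "h \<in> L2 \<mu>"
  shows "Plift_op T \<rho> h \<in> L2 \<mu>"
  unfolding L2_lift_measure_iff Plift_op_apply using slice_L2[OF assms]
  by (intro ballI L2_add kact_L2 L2_mult_hold L2_mult_rho) auto

lemma ip_Plift_op_slice:
  assumes v: "v \<in> {-1, 1}" and k: "k \<in> L2 \<pi>" and h: "h \<in> L2 \<mu>"
  shows "ip \<pi> k (\<lambda>x. Plift_op T \<rho> h (x, v)) = ip \<pi> k (kact (T v) (\<lambda>y. h (y, v)))
    + ip \<pi> k (\<lambda>x. h (x, v) * hold v x) + ip \<pi> k (\<lambda>x. h (x, -v) * \<rho> v x)"
proof -
  note L = kact_L2[OF v slice_L2[OF h v]] L2_mult_hold[OF v slice_L2[OF h v]]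
    L2_mult_rho[OF v slice_L2[OF h neg_sign[OF v]]]
  from ip_add_scale_right[OF k L2_add[OF L(1,2)] L(3), of 1] ip_add_scale_right[OF k L(1,2), of 1]
  show ?thesis
    unfolding Plift_op_apply by simp
qed

lemma ip_Plift_op_linear:
  assumes k: "k \<in> L2 \<mu>" and g: "g \<in> L2 \<mu>" and h: "h \<in> L2 \<mu>"
  shows "ip \<mu> k (Plift_op T \<rho> (\<lambda>p. g p + c * h p)) = ip \<mu> k (Plift_op T \<rho> g) + c * ip \<mu> k (Plift_op T \<rho> h)"
proof -
  have slice: "ip \<pi> (\<lambda>x. k (x, v)) (\<lambda>x. Plift_op T \<rho> (\<lambda>p. g p + c * h p) (x, v)) =
      ip \<pi> (\<lambda>x. k (x, v)) (\<lambda>x. Plift_op T \<rho> g (x, v)) + c * ip \<pi> (\<lambda>x. k (x, v)) (\<lambda>x. Plift_op T \<rho> h (x, v))"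
    if v: "v \<in> {-1, 1}" for v
  proof -
    note nv = neg_sign[OF v]
    note k' = slice_L2[OF k v] and g' = slice_L2[OF g v] slice_L2[OF g nv] and h' = slice_L2[OF h v] slice_L2[OF h nv]
    have "ip \<pi> (\<lambda>x. k (x, v)) (\<lambda>x. (g (x, v) + c * h (x, v)) * hold v x)
      = ip \<pi> (\<lambda>x. k (x, v)) (\<lambda>x. g (x, v) * hold v x) + c * ip \<pi> (\<lambda>x. k (x, v)) (\<lambda>x. h (x, v) * hold v x)"
      using ip_add_scale_right[OF k' L2_mult_hold[OF v g'(1)] L2_mult_hold[OF v h'(1)], of c]
      by (simp add: algebra_simps)
    moreover have "ip \<pi> (\<lambda>x. k (x, v)) (\<lambda>x. (g (x, -v) + c * h (x, -v)) * \<rho> v x)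
      = ip \<pi> (\<lambda>x. k (x, v)) (\<lambda>x. g (x, -v) * \<rho> v x) + c * ip \<pi> (\<lambda>x. k (x, v)) (\<lambda>x. h (x, -v) * \<rho> v x)"
      using ip_add_scale_right[OF k' L2_mult_rho[OF v g'(2)] L2_mult_rho[OF v h'(2)], of c]
      by (simp add: algebra_simps)
    ultimately show ?thesis
      using ip_kact_add_scale[OF v k' g'(1) h'(1), of c]
      by (simp add: ip_Plift_op_slice[OF v k'] L2_add_scale g h algebra_simps)
  qed
  show ?thesis
    using slice[of 1] slice[of "-1"] k g h
    by (simp add: ip_\<mu> Plift_op_L2 L2_add_scale field_simps)
qed

text \<open>The adjoint of the lifted operator is its conjugate by the flip, term by term: moves use
  the adjointness of \<open>T v\<close> and \<open>T (-v)\<close>, holding uses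
  \<open>hold_flip\<close>, and the switching term is a regrouped product with the same factor
  \<open>\<rho> v\<close>.\<close>

lemma ip_Plift_op_flip:
  assumes k: "k \<in> L2 \<mu>" and h: "h \<in> L2 \<mu>"
  shows "ip \<mu> k (Plift_op T \<rho> h) = ip \<mu> (flip h) (Plift_op T \<rho> (flip k))"
proof -
  have slice: "ip \<pi> (\<lambda>x. k (x, v)) (kact (T v) (\<lambda>y. h (y, v))) = ip \<pi> (\<lambda>x. h (x, v)) (kact (T (-v)) (\<lambda>y. k (y, v)))"
    "ip \<pi> (\<lambda>x. k (x, v)) (\<lambda>x. h (x, v) * hold v x) = ip \<pi> (\<lambda>x. h (x, v)) (\<lambda>x. k (x, v) * hold (-v) x)"
    "ip \<pi> (\<lambda>x. k (x, v)) (\<lambda>x. h (x, -v) * \<rho> v x) = ip \<pi> (\<lambda>x. h (x, -v)) (\<lambda>x. k (x, v) * \<rho> v x)"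
    if v: "v \<in> {-1, 1}" for v
    using ip_kact_swap[OF v slice_L2[OF k v] slice_L2[OF h v]] hold_flip[OF v]
    by (auto simp: ip_def mult_ac intro!: Bochner_Integration.integral_cong)
  have fl: "flip g (x, v) = g (x, -v)" for g :: "'a \<times> int \<Rightarrow> real" and x v
    by (simp add: flip_def)
  show ?thesis
    using slice[of 1] slice[of "-1"] slice_L2[OF k] slice_L2[OF h] k h
    by (simp add: ip_\<mu> Plift_op_L2 flip_L2 ip_Plift_op_slice fl)
qed

section \<open>Contraction of the lifted operator\<close>

lemma AE_Plift_op_power2_le:
  assumes v: "v \<in> {-1, 1}" and h: "h \<in> L2 \<mu>"
  shows "AE x in \<pi>. (Plift_op T \<rho> h (x, v))\<^sup>2 \<le>
    kact (T v) (\<lambda>y. (h (y, v))\<^sup>2) x + (h (x, v))\<^sup>2 * hold v x + (h (x, -v))\<^sup>2 * \<rho> v x"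
  using AE_L2_T[OF v slice_L2[OF h v]] AE_space
proof eventually_elim
  case (elim x)
  \<comment> \<open>The common tangent point is the mean of \<open>h\<close> under the whole row.
    The three tangent bounds add up to \<open>2 * t * t\<close> minus \<open>t\<^sup>2\<close> times
    the total mass 1.\<close>
  define t where "t = Plift_op T \<rho> h (x, v)"
  have tangent: "2 * t * s - t\<^sup>2 \<le> s\<^sup>2" for s
    using zero_le_power2[of "s - t"] by (simp add: power2_diff algebra_simps)
  have "2 * t * kact (T v) (\<lambda>y. h (y, v)) x - t\<^sup>2 * kmass (T v) x \<le> kact (T v) (\<lambda>y. (h (y, v))\<^sup>2) x"
    unfolding kact_def kmass_def
    using subprob_space.power2_integral_tangent[OF subprob_T[OF v elim(2)] elim(1)] .
  moreover have "(2 * t * h (x, v) - t\<^sup>2) * hold v x \<le> (h (x, v))\<^sup>2 * hold v x"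
    using hold_nonneg[OF v elim(2)] by (intro mult_right_mono tangent)
  moreover have "(2 * t * h (x, -v) - t\<^sup>2) * \<rho> v x \<le> (h (x, -v))\<^sup>2 * \<rho> v x"
    using rho_nonneg[OF elim(2) v] by (intro mult_right_mono tangent)
  moreover have "2 * t * kact (T v) (\<lambda>y. h (y, v)) x - t\<^sup>2 * kmass (T v) x
      + (2 * t * h (x, v) - t\<^sup>2) * hold v x + (2 * t * h (x, -v) - t\<^sup>2) * \<rho> v x
    = 2 * t * t - t\<^sup>2 * (kmass (T v) x + hold v x + \<rho> v x)"
    by (simp add: t_def Plift_op_apply algebra_simps)
  moreover have "kmass (T v) x + hold v x + \<rho> v x = 1"
    by (simp add: hold_def)
  ultimately show ?case
    by (simp add: t_def[symmetric] power2_eq_square)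
qed

text \<open>Integrate Jensen's bound over the rows and use invariance of \<open>\<mu>\<close>.
  Reversibility turns the moves with velocity \<open>v\<close> into the weight
  \<open>kmass (T (-v))\<close>, after which the terms are regrouped by the slice of
  \<open>h\<close> they contain.\<close>

lemma Plift_op_contraction:
  assumes h: "h \<in> L2 \<mu>"
  shows "ip \<mu> (Plift_op T \<rho> h) (Plift_op T \<rho> h) \<le> ip \<mu> h h"
proof -
  have slice: "ip \<pi> (\<lambda>x. Plift_op T \<rho> h (x, v)) (\<lambda>x. Plift_op T \<rho> h (x, v)) \<le>
      (\<integral>x. (h (x, v))\<^sup>2 * kmass (T (-v)) x \<partial>\<pi>) + (\<integral>x. (h (x, v))\<^sup>2 * hold v x \<partial>\<pi>) + (\<integral>x. (h (x, -v))\<^sup>2 * \<rho> v x \<partial>\<pi>)"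
    if v: "v \<in> {-1, 1}" for v
  proof -
    note hv = slice_L2[OF h v] slice_L2[OF h neg_sign[OF v]]
    note I = integrable_kact_power2[OF v hv(1)] integrable_power2_mult[OF hv(1) L2_mult_hold[OF v hv(1)]]
      integrable_power2_mult[OF hv(2) L2_mult_rho[OF v hv(2)]]
    have "ip \<pi> (\<lambda>x. Plift_op T \<rho> h (x, v)) (\<lambda>x. Plift_op T \<rho> h (x, v))
      \<le> (\<integral>x. kact (T v) (\<lambda>y. (h (y, v))\<^sup>2) x + (h (x, v))\<^sup>2 * hold v x + (h (x, -v))\<^sup>2 * \<rho> v x \<partial>\<pi>)"
      unfolding ip_def power2_eq_square[symmetric]
      using I L2_integrable_power2[OF slice_L2[OF Plift_op_L2[OF h] v]] AE_Plift_op_power2_le[OF v h]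
      by (intro integral_mono_AE) auto
    also have "\<dots> = (\<integral>x. (h (x, v))\<^sup>2 * kmass (T (-v)) x \<partial>\<pi>) + (\<integral>x. (h (x, v))\<^sup>2 * hold v x \<partial>\<pi>)
        + (\<integral>x. (h (x, -v))\<^sup>2 * \<rho> v x \<partial>\<pi>)"
      using I integral_kact_power2[OF v hv(1)] by simp
    finally show ?thesis .
  qed
  \<comment> \<open>These are the weights flowing into the state \<open>(x, v)\<close>, the last one
    coming from the estimate for velocity \<open>-v\<close>. By \<open>rho_diff\<close> they sum to
    1.\<close>
  have total: "(\<integral>x. (h (x, v))\<^sup>2 * kmass (T (-v)) x \<partial>\<pi>) + (\<integral>x. (h (x, v))\<^sup>2 * hold v x \<partial>\<pi>)
      + (\<integral>x. (h (x, v))\<^sup>2 * \<rho> (-v) x \<partial>\<pi>) = ip \<pi> (\<lambda>x. h (x, v)) (\<lambda>x. h (x, v))"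
    if v: "v \<in> {-1, 1}" for v
  proof -
    note nv = neg_sign[OF v] and hv = slice_L2[OF h v]
    have "(\<lambda>x. h (x, v) * kmass (T (-v)) x) \<in> L2 \<pi>"
      using kmass_le_1[OF nv] kmass_nonneg by (intro L2_bounded_mult[OF hv] kmass_measurable nv) auto
    note I = integrable_power2_mult[OF hv this] integrable_power2_mult[OF hv L2_mult_hold[OF v hv]]
      integrable_power2_mult[OF hv L2_mult_rho[OF nv hv]]
    have "(\<integral>x. (h (x, v))\<^sup>2 * kmass (T (-v)) x \<partial>\<pi>) + (\<integral>x. (h (x, v))\<^sup>2 * hold v x \<partial>\<pi>)
      + (\<integral>x. (h (x, v))\<^sup>2 * \<rho> (-v) x \<partial>\<pi>)
      = (\<integral>x. (h (x, v))\<^sup>2 * kmass (T (-v)) x + (h (x, v))\<^sup>2 * hold v x + (h (x, v))\<^sup>2 * \<rho> (-v) x \<partial>\<pi>)"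
      using I by simp
    also have "\<dots> = (\<integral>x. (h (x, v))\<^sup>2 \<partial>\<pi>)"
    proof (intro Bochner_Integration.integral_cong refl)
      fix x assume "x \<in> space \<pi>"
      then have "kmass (T (-v)) x + hold v x + \<rho> (-v) x = 1"
        using rho_diff[OF _ v, of x] by (simp add: hold_def)
      then show "(h (x, v))\<^sup>2 * kmass (T (-v)) x + (h (x, v))\<^sup>2 * hold v x + (h (x, v))\<^sup>2 * \<rho> (-v) x = (h (x, v))\<^sup>2"
        by (simp flip: distrib_left)
    qed
    finally show ?thesis
      by (simp add: ip_def power2_eq_square)
  qed
  show ?thesis
    using slice[of 1] slice[of "-1"] total[of 1] total[of "-1"] h
    by (simp add: ip_\<mu> Plift_op_L2)
qed

sublocale lifted: L2_contraction \<mu> "Plift_op T \<rho>"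
  by unfold_locales (auto intro: Plift_op_L2 ip_Plift_op_linear Plift_op_contraction)

text \<open>On a function blind to the velocity, switching is the same as holding, so
  \<open>\<rho>\<close> cancels. Thus \<open>P_op T\<close> is the compression of the lifted
  operator to functions of position.\<close>

lemma P_op_eq_even_part: "P_op T e = even_part (Plift_op T \<rho> (lift_fun e))"
  by (auto simp: P_op_def Plift_op_def even_part_def lift_fun_def field_simps)

lemma ip_P_op:
  "a \<in> L2 \<pi> \<Longrightarrow> b \<in> L2 \<pi> \<Longrightarrow> ip \<pi> a (P_op T b) = ip \<mu> (lift_fun a) (Plift_op T \<rho> (lift_fun b))"
  by (simp add: P_op_eq_even_part ip_lift_fun Plift_op_L2 lift_fun_L2)

text \<open>Lifted functions are fixed by the flip, so the twisted adjointness of the lifted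
  operator becomes symmetry of its compression.\<close>

lemma ip_P_op_commute: "a \<in> L2 \<pi> \<Longrightarrow> b \<in> L2 \<pi> \<Longrightarrow> ip \<pi> a (P_op T b) = ip \<pi> b (P_op T a)"
  by (simp add: ip_P_op ip_Plift_op_flip[of "lift_fun a"] lift_fun_L2 flip_lift_fun)

text \<open>Contraction and weak linearity are inherited from the lifted operator by compression.
  The squared norm of \<open>P_op T g\<close> is a pairing with the lifted image of
  \<open>g\<close>, and half of it is absorbed on the left.\<close>

sublocale reversible: L2_contraction \<pi> "P_op T"
proof
  fix g assume g: "g \<in> L2 \<pi>"
  show P: "P_op T g \<in> L2 \<pi>"
    by (simp add: P_op_eq_even_part even_part_L2 Plift_op_L2 lift_fun_L2 g)
  have "2 * ip \<pi> (P_op T g) (P_op T g) \<le> ip \<pi> (P_op T g) (P_op T g)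
      + ip \<mu> (Plift_op T \<rho> (lift_fun g)) (Plift_op T \<rho> (lift_fun g))"
    using abs_ip_le[OF lift_fun_L2[OF P] Plift_op_L2[OF lift_fun_L2[OF g]]]
    by (simp add: ip_P_op[symmetric] P g ip_lift_fun_lift_fun)
  then show "ip \<pi> (P_op T g) (P_op T g) \<le> ip \<pi> g g"
    using Plift_op_contraction[OF lift_fun_L2[OF g]] by (simp add: ip_lift_fun_lift_fun g)
next
  fix k g h c assume "k \<in> L2 \<pi>" "g \<in> L2 \<pi>" "h \<in> L2 \<pi>"
  moreover have "lift_fun (\<lambda>x. g x + c * h x) = (\<lambda>p. lift_fun g p + c * lift_fun h p)"
    by (auto simp: lift_fun_def)
  ultimately show "ip \<pi> k (P_op T (\<lambda>x. g x + c * h x)) = ip \<pi> k (P_op T g) + c * ip \<pi> k (P_op T h)"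
    by (simp add: ip_P_op L2_add_scale ip_Plift_op_linear lift_fun_L2)
qed

section \<open>Comparison of the two resolvents\<close>

lemma dirichlet_even_part_le:
  assumes u: "u \<in> L2 \<mu>" and lam: "0 \<le> lam" "lam < 1"
  shows "ip \<pi> (even_part u) (even_part u) - lam * ip \<pi> (even_part u) (P_op T (even_part u))
    \<le> ip \<mu> u u - lam * ip \<mu> u (Plift_op T \<rho> u)"
proof -
  define E where "E = lift_fun (even_part u)"
  define D where "D = (\<lambda>p. u p - E p)"
  have e: "even_part u \<in> L2 \<pi>" and E: "E \<in> L2 \<mu>" and D: "D \<in> L2 \<mu>"
    using u by (auto simp: E_def D_def intro!: even_part_L2 lift_fun_L2 L2_diff)
  have u_eq: "u = (\<lambda>p. E p + 1 * D p)"
    by (simp add: D_def)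
  \<comment> \<open>\<open>D\<close> is odd only at the velocities -1 and 1, so the sign change is
    stated under the integral instead of as an equality of functions.\<close>
  have odd: "ip \<mu> (flip D) k = - ip \<mu> D k" if "k \<in> L2 \<mu>" for k
  proof -
    have "ip \<mu> (flip D) k = (\<integral>p. - (D p * k p) \<partial>\<mu>)"
      unfolding ip_def
      by (intro Bochner_Integration.integral_cong)
        (auto simp: space_lift_measure flip_def D_def E_def lift_fun_def even_part_def field_simps)
    then show ?thesis by (simp add: ip_def)
  qed
  \<comment> \<open>Passing to the flipped adjoint fixes the even function and negates the odd one.
    The cross terms of the form are therefore opposite and cancel.\<close>
  have "ip \<mu> E (Plift_op T \<rho> D) = - ip \<mu> D (Plift_op T \<rho> E)"
    using ip_Plift_op_flip[OF E D] odd[OF Plift_op_L2[OF E]] by (simp add: E_def flip_lift_fun)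
  then have form: "ip \<mu> u (Plift_op T \<rho> u) = ip \<mu> E (Plift_op T \<rho> E) + ip \<mu> D (Plift_op T \<rho> D)"
    using E D Plift_op_L2[OF E] Plift_op_L2[OF D] u
    by (subst (1 2) u_eq, subst lifted.ip_linear)
      (auto simp: ip_add_scale_left[where c=1, simplified] L2_add)
  have ED: "ip \<mu> E D = 0"
  proof -
    have "even_part D = (\<lambda>x. 0)"
      by (auto simp: D_def E_def even_part_def lift_fun_def field_simps)
    then show ?thesis
      using ip_lift_fun[OF e D] by (simp add: E_def)
  qed
  have "ip \<mu> u u = ip \<mu> E E + ip \<mu> D D"
    using E D ED ip_commute[of \<mu> E D]
    by (subst (1 2) u_eq) (auto simp: ip_add_scale_left[where c=1, simplified]
      ip_add_scale_right[where c=1, simplified] L2_add)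
  \<comment> \<open>Both the norm and the form split into even and odd contributions, and the odd
    contribution to the right-hand side is nonnegative.\<close>
  with form lifted.coercive[OF D lam] show ?thesis
    by (simp add: ip_P_op e E_def[symmetric] distrib_left)
      (simp add: E_def ip_lift_fun_lift_fun e)
qed

text \<open>This is the resolvent comparison for truncated series. Each truncated equation leaves a
  remainder bounded by \<open>C\<close>, and these remainders make up the additional term.\<close>

lemma ip_resolvent_sum_le:
  assumes g: "g \<in> L2 \<pi>" and lam: "0 \<le> lam" "lam < 1"
  shows "ip \<mu> (lift_fun g) (lifted.resolvent_sum lam (lift_fun g) n)
    \<le> ip \<pi> g (reversible.resolvent_sum lam g n) + 4 * (lam ^ n * (ip \<pi> g g / (1 - lam)))"
proof -
  define u where "u = lifted.resolvent_sum lam (lift_fun g) n"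
  define w where "w = reversible.resolvent_sum lam g n"
  define e where "e = even_part u"
  define C where "C = lam ^ n * (ip \<pi> g g / (1 - lam))"
  define rP where "rP = (P_op T ^^ n) g"
  define rL where "rL = (Plift_op T \<rho> ^^ n) (lift_fun g)"
  note lg = lift_fun_L2[OF g]
  have u: "u \<in> L2 \<mu>" and w: "w \<in> L2 \<pi>" and rP: "rP \<in> L2 \<pi>" and rL: "rL \<in> L2 \<mu>"
    unfolding u_def w_def rP_def rL_def
    by (simp_all add: lg g lifted.resolvent_sum_L2 reversible.resolvent_sum_L2 lifted.power_closed reversible.power_closed)
  have e: "e \<in> L2 \<pi>"
    unfolding e_def using u by (rule even_part_L2)
  have Pw: "P_op T w \<in> L2 \<pi>" and Pe: "P_op T e \<in> L2 \<pi>"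
    using w e by (auto intro: reversible.closed)
  have ge: "ip \<mu> (lift_fun g) u = ip \<pi> g e"
    unfolding e_def using g u by (rule ip_lift_fun)
  have small: "\<bar>lam ^ n * s\<bar> \<le> C" if "\<bar>s\<bar> \<le> ip \<pi> g g / (1 - lam)" for s
    using mult_left_mono[OF that, of "lam ^ n"] lam by (simp add: C_def abs_mult)
  have rP_le: "ip \<pi> rP rP \<le> ip \<pi> g g"
    unfolding rP_def using g by (rule reversible.power_contraction)
  have b1: "\<bar>lam ^ n * ip \<mu> u rL\<bar> \<le> C"
    using lifted.abs_ip_resolvent_sum_le[OF lg rL _ lam, of n] lifted.power_contraction[OF lg, of n]
    by (intro small) (simp add: ip_commute[of \<mu> u rL] rL_def[symmetric] u_def[symmetric] ip_lift_fun_lift_fun g)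
  have b2: "\<bar>lam ^ n * ip \<pi> w rP\<bar> \<le> C"
    using reversible.abs_ip_resolvent_sum_le[OF g rP rP_le lam, of n]
    by (intro small) (simp add: ip_commute[of \<pi> w rP] w_def[symmetric])
  \<comment> \<open>Since \<open>e\<close> is the even part of \<open>u\<close>, the pairing equals
    that of \<open>u\<close> with the lift of \<open>rP\<close>, so the uniform bound for the lifted
    partial sums applies.\<close>
  have b3: "\<bar>lam ^ n * ip \<pi> e rP\<bar> \<le> C"
    using lifted.abs_ip_resolvent_sum_le[OF lg lift_fun_L2[OF rP] _ lam, of n] rP_le
    by (intro small) (simp add: ip_lift_fun_lift_fun g rP ip_lift_fun[OF rP u] ip_commute[of \<pi> e rP] e_def[symmetric] u_def[symmetric])
  have eq1: "ip \<mu> u u - lam * ip \<mu> u (Plift_op T \<rho> u) = ip \<pi> g e - lam ^ n * ip \<mu> u rL"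
    using lifted.resolvent_sum_equation[OF lg u, of lam n] ge
    by (simp add: u_def[symmetric] rL_def[symmetric] ip_commute[of \<mu> u "lift_fun g"])
  have eq2: "ip \<pi> w w - lam * ip \<pi> w (P_op T w) = ip \<pi> g w - lam ^ n * ip \<pi> w rP"
    using reversible.resolvent_sum_equation[OF g w, of lam n]
    by (simp add: w_def[symmetric] rP_def[symmetric] ip_commute[of \<pi> w g])
  have eq3: "ip \<pi> e w - lam * ip \<pi> e (P_op T w) = ip \<pi> g e - lam ^ n * ip \<pi> e rP"
    using reversible.resolvent_sum_equation[OF g e, of lam n]
    by (simp add: w_def[symmetric] rP_def[symmetric] ip_commute[of \<pi> e g])
  \<comment> \<open>Nonnegativity of the form of \<open>1 - lam P\<close> at \<open>w - e\<close> is
    the variational inequality for the resolvent of \<open>P\<close>, with \<open>e\<close> as trial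
    function.\<close>
  define z where "z = (\<lambda>x. w x + (-1) * e x)"
  have z: "z \<in> L2 \<pi>"
    unfolding z_def using w e by (rule L2_add_scale)
  have "ip \<pi> z (P_op T z) = ip \<pi> z (P_op T w) - ip \<pi> z (P_op T e)"
    using reversible.ip_linear[OF z w e, of "-1"] by (simp add: z_def)
  also have "\<dots> = ip \<pi> w (P_op T w) - 2 * ip \<pi> e (P_op T w) + ip \<pi> e (P_op T e)"
    using ip_add_scale_left[OF Pw w e, of "-1"] ip_add_scale_left[OF Pe w e, of "-1"] ip_P_op_commute[OF w e]
    by (simp add: z_def)
  finally have zPz: "ip \<pi> z (P_op T z) = ip \<pi> w (P_op T w) - 2 * ip \<pi> e (P_op T w) + ip \<pi> e (P_op T e)" .
  have "ip \<pi> z z = ip \<pi> z w - ip \<pi> z e"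
    using ip_add_scale_right[OF z w e, of "-1"] by (simp add: z_def)
  also have "\<dots> = ip \<pi> w w - 2 * ip \<pi> e w + ip \<pi> e e"
    using ip_add_scale_left[OF w w e, of "-1"] ip_add_scale_left[OF e w e, of "-1"] ip_commute[of \<pi> w e]
    by (simp add: z_def)
  finally have zz: "ip \<pi> z z = ip \<pi> w w - 2 * ip \<pi> e w + ip \<pi> e e" .
  have "lam * (ip \<pi> w (P_op T w) - 2 * ip \<pi> e (P_op T w) + ip \<pi> e (P_op T e)) \<le> ip \<pi> w w - 2 * ip \<pi> e w + ip \<pi> e e"
    using reversible.coercive[OF z lam] unfolding zz zPz .
  moreover have "ip \<pi> e e - lam * ip \<pi> e (P_op T e) \<le> ip \<pi> g e - lam ^ n * ip \<mu> u rL"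
    using dirichlet_even_part_le[OF u lam] unfolding eq1 e_def .
  \<comment> \<open>The remainders of \<open>eq1\<close> and \<open>eq2\<close> enter once each and
    that of \<open>eq3\<close> twice, through the doubled cross term; hence the factor 4.\<close>
  ultimately have "ip \<pi> g e \<le> ip \<pi> g w + 4 * C"
    using b1 b2 b3 eq2 eq3 by (simp add: algebra_simps abs_le_iff)
  then show ?thesis
    unfolding ge u_def[symmetric] w_def[symmetric] C_def .
qed

text \<open>For centred \<open>g\<close>, each variance is twice the limiting pairing of
  \<open>g\<close> with its resolvent, minus the squared norm of \<open>g\<close>. That norm is the
  same on both sides, so the comparison of partial sums passes to the limit.\<close>

lemma var_lam_lifted_le:
  assumes lam: "0 \<le> lam" "lam < 1" and f: "f \<in> L2 \<pi>"
  shows "var_lam \<mu> (Plift_op T \<rho>) lam (lift_fun f) \<le> var_lam \<pi> (P_op T) lam f"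
proof -
  define g where "g = (\<lambda>x. f x - (\<integral>y. f y \<partial>\<pi>))"
  have f_int: "integrable \<pi> f"
    using f by (rule L2_integrable)
  have "(\<lambda>x. c) \<in> L2 \<pi>" for c
    by (simp add: L2_def)
  then have g: "g \<in> L2 \<pi>"
    unfolding g_def using f by (intro L2_diff)
  have "(\<integral>p. lift_fun f p \<partial>\<mu>) = (\<integral>y. f y \<partial>\<pi>)"
    using f_int sigma_finite_measure_axioms by (subst integral_lift_measure) (auto simp: lift_fun_def)
  \<comment> \<open>The lift preserves the mean, so centring before or after lifting gives the same
    function.\<close>
  then have lg: "lift_fun g = (\<lambda>p. lift_fun f p - (\<integral>p. lift_fun f p \<partial>\<mu>))"
    by (auto simp: lift_fun_def g_def)
  let ?A = "ip \<mu> (lift_fun g) (lift_fun g) + (\<Sum>k. lam ^ Suc k * ip \<mu> (lift_fun g) ((Plift_op T \<rho> ^^ Suc k) (lift_fun g)))"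
  let ?B = "ip \<pi> g g + (\<Sum>k. lam ^ Suc k * ip \<pi> g ((P_op T ^^ Suc k) g))"
  have "(\<lambda>n. lam ^ n) \<longlonglongrightarrow> 0"
    using lam by (intro LIMSEQ_realpow_zero) auto
  then have "(\<lambda>n. ip \<pi> g (reversible.resolvent_sum lam g n) + 4 * (lam ^ n * (ip \<pi> g g / (1 - lam))))
      \<longlonglongrightarrow> ?B + 4 * (0 * (ip \<pi> g g / (1 - lam)))"
    by (intro tendsto_add tendsto_mult tendsto_const reversible.ip_resolvent_sum_tendsto g lam)
  with lifted.ip_resolvent_sum_tendsto[OF lift_fun_L2[OF g] lam] have "?A \<le> ?B + 4 * (0 * (ip \<pi> g g / (1 - lam)))"
    using ip_resolvent_sum_le[OF g lam] by (intro LIMSEQ_le) auto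
  moreover have "var_lam \<mu> (Plift_op T \<rho>) lam (lift_fun f) = 2 * ?A - ip \<pi> g g"
    unfolding var_lam_def Let_def lg[symmetric]
    by (simp add: ip_def[symmetric] power2_eq_square ip_lift_fun_lift_fun g)
  moreover have "var_lam \<pi> (P_op T) lam f = 2 * ?B - ip \<pi> g g"
    unfolding var_lam_def Let_def g_def[symmetric]
    by (simp add: ip_def[symmetric] power2_eq_square)
  ultimately show ?thesis by simp
qed

end

theorem theorem3p17:
  fixes \<pi> :: "'a measure" and T :: "int \<Rightarrow> 'a \<Rightarrow> 'a measure"
    and \<rho> :: "int \<Rightarrow> 'a \<Rightarrow> real" and lam :: real and f :: "'a \<Rightarrow> real"
  assumes prob: "prob_space \<pi>"
    and kern: "\<And>v. v \<in> {-1, 1} \<Longrightarrow> T v \<in> \<pi> \<rightarrow>\<^sub>M subprob_algebra \<pi>"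
    and rev: "\<And>A B. A \<in> sets \<pi> \<Longrightarrow> B \<in> sets \<pi> \<Longrightarrow>
        (\<integral>x. indicator A x * measure (T 1 x) B \<partial>\<pi>) = (\<integral>y. indicator B y * measure (T (-1) y) A \<partial>\<pi>)"
    and rho_meas: "\<And>v. v \<in> {-1, 1} \<Longrightarrow> \<rho> v \<in> borel_measurable \<pi>"
    and rho_diff: "\<And>x v. x \<in> space \<pi> \<Longrightarrow> v \<in> {-1, 1} \<Longrightarrow>
        \<rho> v x - \<rho> (-v) x = kmass (T (-v)) x - kmass (T v) x"
    and rho_low: "\<And>x v. x \<in> space \<pi> \<Longrightarrow> v \<in> {-1, 1} \<Longrightarrow>
        max 0 (kmass (T (-v)) x - kmass (T v) x) \<le> \<rho> v x"
    and rho_up: "\<And>x v. x \<in> space \<pi> \<Longrightarrow> v \<in> {-1, 1} \<Longrightarrow>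
        \<rho> v x \<le> 1 - kmass (T v) x"
    and lam: "0 \<le> lam" "lam < 1"
    and f_meas: "f \<in> borel_measurable \<pi>"
    and f_L2: "integrable \<pi> (\<lambda>x. (f x)\<^sup>2)"
  shows "var_lam (lift_measure \<pi>) (Plift_op T \<rho>) lam (\<lambda>(x, v). f x)
           \<le> var_lam \<pi> (P_op T) lam f"
proof -
  interpret prob_space \<pi> by fact
  interpret lifted_chain \<pi> T \<rho>
  proof
    show "0 \<le> \<rho> v x" if "x \<in> space \<pi>" "v \<in> {-1, 1}" for x v
      using rho_low[OF that] by simp
  qed (fact kern rev rho_meas rho_diff rho_up)+
  have "f \<in> L2 \<pi>"
    using f_meas f_L2 by (simp add: L2_def)
  from var_lam_lifted_le[OF lam this] show ?thesis
    by (simp add: lift_fun_def)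
qed

end
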